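(* Let $J_{15}=J_{15,0}$ be the color graph of order 15 and rank 5 obtained by the switching $Sw_0$ from the symmetrization $NJ_{15}$ of the rank 6 association scheme of 2-orbits of the transitive action of $A_5$ on 15 points. Then the Jordan scheme $J_{15}$ is proper.
   Context: An association scheme (AS) on a finite set $\Omega$ is a partition of $\Omega^2$ into nonempty relations, one of which is the identity relation, closed under transposition, whose adjacency matrices span a matrix algebra (closed under the usual product); it may be non-symmetric and non-commutative. A Jordan scheme on $\Omega$ is a partition of $\Omega^2$ into nonempty symmetric relations, one of which is the identity relation, such that the real linear span of the adjacency matrices is closed under the Jordan product $A*B=\frac12(AB+BA)$. The symmetrization of an AS is obtained by replacing each relation $R$ by $R\cup R^T$. A Jordan scheme is non-proper if it is the symmetrization of some AS, and proper otherwise. Setting: let $\Omega$ be the set of the 15 structures $\{\{a,b\},\{c,d\}\}$, where $\{a,b\}$ and $\{c,d\}$ are disjoint 2-subsets of $\{0,1,2,3,4\}$, with the natural transitive action of the alternating group $A_5$. The orbits of $A_5$ on $\Omega^2$ (2-orbits) are: the identity relation, two mutually transposed relations $S_1,S_2=S_1^T$ of valency 1, and three symmetric relations $\Delta_0,\Delta_1,\Delta_2$ of valency 4. The symmetrization $NJ_{15}$ has relations $\mathrm{Id}_{15}$, $S=S_1\cup S_2$, $\Delta_0,\Delta_1,\Delta_2$. The relation $\mathrm{Id}_{15}\cup S$ is an equivalence relation with five classes (fibers) of size 3. Fix one fiber (the island, with 3 points); the remaining 12 points form the continent. Let $T_i$ (denoted $TT_i$ in the paper) be the restriction of $\Delta_i$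 to the continent and let the bridge $Br_i$ be the set of pairs of $\Delta_i$ (in both directions) between island and continent, so that $\Delta_i=T_i\cup Br_i$. The switching $Sw_0$ keeps $Br_0$ and interchanges $Br_1$ and $Br_2$: the color graph $J_{15}=J_{15,0}$ has the five relations $\mathrm{Id}_{15}$, $S$, $\Delta_0$, $\Delta'_1=T_1\cup Br_2$, $\Delta'_2=T_2\cup Br_1$. *)

theory Defs
  imports Complex_Main "HOL-Library.Disjoint_Sets" "HOL-Combinatorics.Permutations"
begin

section \<open>Association schemes and Jordan schemes\<close>

text \<open>
  Real matrices with rows and columns indexed by a finite set \<open>\<Omega>\<close> are functions
  \<open>'a \<Rightarrow> 'a \<Rightarrow> real\<close>. All matrices below are combinations of adjacency matrices of relations
  contained in \<open>\<Omega> \<times> \<Omega>\<close>, hence vanish outside \<open>\<Omega> \<times> \<Omega>\<close>, so that equality of functions is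
  equality of matrices.
\<close>

definition adj :: "'a rel \<Rightarrow> 'a \<Rightarrow> 'a \<Rightarrow> real"
  where "adj R = (\<lambda>x y. if (x, y) \<in> R then 1 else 0)"

definition mat_prod :: "'a set \<Rightarrow> ('a \<Rightarrow> 'a \<Rightarrow> real) \<Rightarrow> ('a \<Rightarrow> 'a \<Rightarrow> real) \<Rightarrow> 'a \<Rightarrow> 'a \<Rightarrow> real"
  where "mat_prod \<Omega> A B = (\<lambda>x y. \<Sum>z\<in>\<Omega>. A x z * B z y)"

definition jordan_prod :: "'a set \<Rightarrow> ('a \<Rightarrow> 'a \<Rightarrow> real) \<Rightarrow> ('a \<Rightarrow> 'a \<Rightarrow> real) \<Rightarrow> 'a \<Rightarrow> 'a \<Rightarrow> real"
  where "jordan_prod \<Omega> A B = (\<lambda>x y. (1/2) * (mat_prod \<Omega> A B x y + mat_prod \<Omega> B A x y))"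

text \<open>The real linear span of the adjacency matrices; meaningful for a finite set of relations.\<close>

definition adj_span :: "'a rel set \<Rightarrow> ('a \<Rightarrow> 'a \<Rightarrow> real) set"
  where "adj_span C = {M. \<exists>c :: 'a rel \<Rightarrow> real. M = (\<lambda>x y. \<Sum>R\<in>C. c R * adj R x y)}"

text \<open>\<^const>\<open>partition_on\<close> includes that the parts are nonempty.\<close>

definition association_scheme :: "'a set \<Rightarrow> 'a rel set \<Rightarrow> bool"
  where "association_scheme \<Omega> C \<longleftrightarrow>
    finite \<Omega> \<and> partition_on (\<Omega> \<times> \<Omega>) C \<and> Id_on \<Omega> \<in> C \<and>
    (\<forall>R\<in>C. R\<inverse> \<in> C) \<and>
    (\<forall>A\<in>adj_span C. \<forall>B\<in>adj_span C. mat_prod \<Omega> A B \<in> adj_span C)"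

definition jordan_scheme :: "'a set \<Rightarrow> 'a rel set \<Rightarrow> bool"
  where "jordan_scheme \<Omega> C \<longleftrightarrow>
    finite \<Omega> \<and> partition_on (\<Omega> \<times> \<Omega>) C \<and> Id_on \<Omega> \<in> C \<and>
    (\<forall>R\<in>C. sym R) \<and>
    (\<forall>A\<in>adj_span C. \<forall>B\<in>adj_span C. jordan_prod \<Omega> A B \<in> adj_span C)"

definition symmetrization :: "'a rel set \<Rightarrow> 'a rel set"
  where "symmetrization C = (\<lambda>R. R \<union> R\<inverse>) ` C"

definition proper_jordan_scheme :: "'a set \<Rightarrow> 'a rel set \<Rightarrow> bool"
  where "proper_jordan_scheme \<Omega> C \<longleftrightarrow>
    jordan_scheme \<Omega> C \<and> \<not> (\<exists>C'. association_scheme \<Omega> C' \<and> C = symmetrization C')"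

definition has_valency :: "'a set \<Rightarrow> 'a rel \<Rightarrow> nat \<Rightarrow> bool"
  where "has_valency \<Omega> R k \<longleftrightarrow> (\<forall>x\<in>\<Omega>. card (R `` {x}) = k)"

section \<open>The action of the alternating group of degree 5 on 15 points\<close>

definition structures15 :: "nat set set set"
  where "structures15 = {{P, Q} | P Q.
    P \<subseteq> {0..4} \<and> Q \<subseteq> {0..4} \<and> card P = 2 \<and> card Q = 2 \<and> P \<inter> Q = {}}"

definition A5 :: "(nat \<Rightarrow> nat) set"
  where "A5 = {p. p permutes {0..4} \<and> evenperm p}"

definition act :: "(nat \<Rightarrow> nat) \<Rightarrow> nat set set \<Rightarrow> nat set set"
  where "act p s = (\<lambda>P. p ` P) ` s"

definition two_orbits15 :: "nat set set rel set"
  where "two_orbits15 =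
    {{(act p x, act p y) | p. p \<in> A5} | x y. x \<in> structures15 \<and> y \<in> structures15}"

definition NJ15 :: "nat set set rel set"
  where "NJ15 = symmetrization two_orbits15"

section \<open>Switching with respect to an island\<close>

text \<open>The restriction of a relation to the continent, and its bridge to the island \<open>F\<close>.\<close>

definition continent_part :: "'a set \<Rightarrow> 'a set \<Rightarrow> 'a rel \<Rightarrow> 'a rel"
  where "continent_part \<Omega> F R = R \<inter> ((\<Omega> - F) \<times> (\<Omega> - F))"

definition bridge :: "'a set \<Rightarrow> 'a set \<Rightarrow> 'a rel \<Rightarrow> 'a rel"
  where "bridge \<Omega> F R = R \<inter> (F \<times> (\<Omega> - F) \<union> (\<Omega> - F) \<times> F)"

text \<open>
  The two relations \<open>D\<^sub>1\<close>, \<open>D\<^sub>2\<close> of the color graph \<open>C\<close> exchange their bridges; every other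
  relation of \<open>C\<close> is kept. It is meant for relations \<open>D\<^sub>1\<close>, \<open>D\<^sub>2\<close> that
  contain no pair of points of the island.
\<close>

definition switching :: "'a set \<Rightarrow> 'a set \<Rightarrow> 'a rel \<Rightarrow> 'a rel \<Rightarrow> 'a rel set \<Rightarrow> 'a rel set"
  where "switching \<Omega> F D\<^sub>1 D\<^sub>2 C = (\<lambda>R.
    if R = D\<^sub>1 then continent_part \<Omega> F D\<^sub>1 \<union> bridge \<Omega> F D\<^sub>2
    else if R = D\<^sub>2 then continent_part \<Omega> F D\<^sub>2 \<union> bridge \<Omega> F D\<^sub>1
    else R) ` C"

end

theory Submission
  imports Defs "HOL-Library.Numeral_Type"
begin

text \<open>
  A picture that explains all the constants: identify the 15 points with the nonzero vectors of
  \<open>F\<^sub>4\<^sup>2\<close> and \<open>A\<^sub>5\<close> with \<open>SL(2,4)\<close>. Let \<open>\<omega>\<close> generate the multiplicative group of \<open>F\<^sub>4\<close>. The map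
  \<open>s x = \<omega> x\<close> permutes the three points of a fiber (a punctured line) cyclically, \<open>S\<^sub>1\<close> is its graph,
  and the three relations of valency 4 are \<open>D i = {(x, y). det (x, y) = \<omega>\<^sup>i}\<close> with \<open>i\<close> read modulo 3.
  They are symmetric because the determinant is alternating and the characteristic is 2, and they
  satisfy \<open>(x, y) \<in> D i \<longleftrightarrow> (s x, y) \<in> D (i + 1)\<close>. This shift rule
  is already forced by the rank, the valencies and the symmetry of the two-orbits (\<open>shift_exists\<close>, \<open>shift_cycle\<close>), after exchanging \<open>S\<^sub>1\<close> and \<open>S\<^sub>2\<close> if necessary.

  The shift rule determines the products. Let \<open>paths i j x y\<close> be the number of \<open>z\<close> with
  \<open>(x, z) \<in> D i\<close> and \<open>(z, y) \<in> D j\<close>, that is, an entry of the product of two adjacency matrices.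
  It is 1 if \<open>x\<close> and \<open>y\<close> lie in different fibers (\<open>paths_off\<close>), and for \<open>y = s\<^sup>k x\<close> it is 4 if
  \<open>j = i + k\<close> and 0 otherwise.

  Exchanging the bridges of \<open>D 1\<close> and \<open>D 2\<close> means negating the index on the bridge. It preserves the
  Jordan products (\<open>sw_paths_sym_sum\<close>): the only delicate entries are those between two points of
  the continent, where a path through the island with colours \<open>i, j\<close> acquires the colours \<open>-i, -j\<close>;
  moving its middle point by \<open>s\<^sup>i\<^sup>+\<^sup>j\<close> turns these into \<open>j, i\<close>, so that the switching merely exchanges
  the two summands of the Jordan product. Hence the switched colour graph is a Jordan scheme.

  The ordinary product is not preserved, and this makes the Jordan scheme proper
  (\<open>switched_proper\<close>). If it were the symmetrization of an association scheme, then \<open>S\<^sub>1 \<union> S\<^sub>2\<close>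
  would be a basic relation \<open>R\<close> together with its transpose, and the product of the adjacency
  matrices of the switched \<open>D 0\<close> and \<open>D 1\<close> would be constant on \<open>R\<close> and on its transpose. But on
  the pairs \<open>(x, s x)\<close> and \<open>(s x, x)\<close> this product takes the values 3 and 1 if \<open>x\<close> is in the
  continent, and the values 0 and 4 if \<open>x\<close> is in the island.
\<close>

section \<open>Spans of adjacency matrices\<close>

lemma mat_prod_adj:
  assumes "finite \<Omega>"
  shows "mat_prod \<Omega> (adj R) (adj Q) x y = real (card {z \<in> \<Omega>. (x, z) \<in> R \<and> (z, y) \<in> Q})"
proof -
  have "mat_prod \<Omega> (adj R) (adj Q) x y = (\<Sum>z\<in>\<Omega>. if (x, z) \<in> R \<and> (z, y) \<in> Q then 1 else 0)"
    unfolding mat_prod_def adj_def by (intro sum.cong) auto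
  then show ?thesis
    using assms by (simp add: sum.If_cases Int_def)
qed

lemma sum_adj_eq:
  assumes "finite C" "partition_on X C" "R \<in> C" "(x, y) \<in> R"
  shows "(\<Sum>Q\<in>C. c Q * adj Q x y) = c R"
proof -
  have "(x, y) \<notin> Q" if "Q \<in> C" "Q \<noteq> R" for Q
    using that assms partition_onD2[OF assms(2)] unfolding disjoint_def by blast
  then have "(\<Sum>Q\<in>C. c Q * adj Q x y) = (\<Sum>Q\<in>C. if Q = R then c R else 0)"
    using assms(4) by (intro sum.cong) (auto simp: adj_def)
  then show ?thesis
    using assms by simp
qed

lemma adj_span_eq:
  assumes "finite C" "partition_on X C" "M \<in> adj_span C"
    and "R \<in> C" "(x, y) \<in> R" "(x', y') \<in> R"
  shows "M x y = M x' y'"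
  using assms(3) sum_adj_eq[OF assms(1,2,4)] assms(5,6) by (auto simp: adj_span_def)

text \<open>
  Together with the preceding lemma, the span of the adjacency matrices of a partition consists of
  the matrices that are constant on every part and vanish elsewhere; this turns closure
  under a product into a counting statement.
\<close>

lemma adj_spanI:
  assumes "finite C" "partition_on X C"
    and const: "\<And>R x y x' y'. \<lbrakk>R \<in> C; (x, y) \<in> R; (x', y') \<in> R\<rbrakk> \<Longrightarrow> M x y = M x' y'"
    and zero: "\<And>x y. (x, y) \<notin> X \<Longrightarrow> M x y = 0"
  shows "M \<in> adj_span C"
proof -
  \<comment> \<open>The coefficient at a part is the value at an arbitrary pair in it.\<close>
  define c where "c R = (let p = SOME p. p \<in> R in M (fst p) (snd p))" for R
  have c: "c R = M x y" if "R \<in> C" "(x, y) \<in> R" for R x y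
  proof -
    have "(SOME p. p \<in> R) \<in> R"
      using that(2) by (rule someI)
    then show ?thesis
      unfolding c_def Let_def by (intro const[OF that(1) _ that(2)]) simp
  qed
  have "M x y = (\<Sum>R\<in>C. c R * adj R x y)" for x y
  proof (cases "(x, y) \<in> X")
    case True
    then obtain R where R: "R \<in> C" "(x, y) \<in> R"
      using assms(2) unfolding partition_on_def by blast
    show ?thesis
      using sum_adj_eq[OF assms(1,2) R] c[OF R] by simp
  next
    case False
    then have "adj R x y = 0" if "R \<in> C" for R
      using that assms(2) unfolding partition_on_def adj_def by auto
    then show ?thesis
      using zero[OF False] by simp
  qed
  then show ?thesis
    unfolding adj_span_def by blast
qed

lemma jordan_prod_sum:
  assumes "finite \<Omega>" "finite C"
  shows "jordan_prod \<Omega> (\<lambda>x y. \<Sum>R\<in>C. a R * adj R x y) (\<lambda>x y. \<Sum>Q\<in>C. b Q * adj Q x y) x y =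
    (\<Sum>R\<in>C. \<Sum>Q\<in>C. a R * b Q * jordan_prod \<Omega> (adj R) (adj Q) x y)"
proof -
  have *: "mat_prod \<Omega> (\<lambda>x y. \<Sum>R\<in>C. a R * adj R x y) (\<lambda>x y. \<Sum>Q\<in>C. b Q * adj Q x y) x y =
      (\<Sum>R\<in>C. \<Sum>Q\<in>C. a R * b Q * mat_prod \<Omega> (adj R) (adj Q) x y)" for a b
  proof -
    have "mat_prod \<Omega> (\<lambda>x y. \<Sum>R\<in>C. a R * adj R x y) (\<lambda>x y. \<Sum>Q\<in>C. b Q * adj Q x y) x y =
        (\<Sum>z\<in>\<Omega>. \<Sum>R\<in>C. \<Sum>Q\<in>C. a R * b Q * (adj R x z * adj Q z y))"
      unfolding mat_prod_def sum_product by (simp add: mult_ac)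
    also have "\<dots> = (\<Sum>R\<in>C. \<Sum>z\<in>\<Omega>. \<Sum>Q\<in>C. a R * b Q * (adj R x z * adj Q z y))"
      by (rule sum.swap)
    also have "\<dots> = (\<Sum>R\<in>C. \<Sum>Q\<in>C. \<Sum>z\<in>\<Omega>. a R * b Q * (adj R x z * adj Q z y))"
      by (intro sum.cong refl sum.swap)
    finally show ?thesis
      by (simp add: mat_prod_def sum_distrib_left)
  qed
  have "mat_prod \<Omega> (\<lambda>x y. \<Sum>Q\<in>C. b Q * adj Q x y) (\<lambda>x y. \<Sum>R\<in>C. a R * adj R x y) x y =
      (\<Sum>R\<in>C. \<Sum>Q\<in>C. a R * b Q * mat_prod \<Omega> (adj Q) (adj R) x y)"
    by (subst *, subst sum.swap) (simp add: mult_ac)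
  then show ?thesis
    unfolding jordan_prod_def *
    by (simp add: sum_distrib_left sum.distrib[symmetric] algebra_simps)
qed

text \<open>
  By bilinearity, only products of two adjacency matrices have to be inspected.
\<close>

lemma jordan_scheme_closedI:
  assumes "finite \<Omega>" "finite C" "partition_on (\<Omega> \<times> \<Omega>) C"
    and const: "\<And>R Q T x y x' y'. \<lbrakk>R \<in> C; Q \<in> C; T \<in> C; (x, y) \<in> T; (x', y') \<in> T\<rbrakk> \<Longrightarrow>
      jordan_prod \<Omega> (adj R) (adj Q) x y = jordan_prod \<Omega> (adj R) (adj Q) x' y'"
    and "A \<in> adj_span C" "B \<in> adj_span C"
  shows "jordan_prod \<Omega> A B \<in> adj_span C"
proof -
  obtain a b where A: "A = (\<lambda>x y. \<Sum>R\<in>C. a R * adj R x y)" and B: "B = (\<lambda>x y. \<Sum>R\<in>C. b R * adj R x y)"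
    using assms(5,6) unfolding adj_span_def by blast
  have out: "adj R x y = 0" if "R \<in> C" "x \<notin> \<Omega> \<or> y \<notin> \<Omega>" for R x y
    using that assms(3) unfolding partition_on_def adj_def by auto
  show ?thesis
  proof (rule adj_spanI[OF assms(2,3)])
    fix T x y x' y' assume "T \<in> C" "(x, y) \<in> T" "(x', y') \<in> T"
    then show "jordan_prod \<Omega> A B x y = jordan_prod \<Omega> A B x' y'"
      unfolding A B jordan_prod_sum[OF assms(1,2)]
      by (intro sum.cong refl) (metis const)
  next
    fix x y assume "(x, y) \<notin> \<Omega> \<times> \<Omega>"
    then have "jordan_prod \<Omega> (adj R) (adj Q) x y = 0" if "R \<in> C" "Q \<in> C" for R Q
      using out[OF that(1)] out[OF that(2)]
      unfolding jordan_prod_def mat_prod_def by auto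
    then show "jordan_prod \<Omega> A B x y = 0"
      unfolding A B jordan_prod_sum[OF assms(1,2)] by simp
  qed
qed

section \<open>Three-fold covers coloured by the integers modulo 3\<close>

lemma cases_mod3:
  fixes i :: 3
  obtains "i = 0" | "i = 1" | "i = 2"
  using that
proof (induct i)
  case (of_int z)
  then have "z = 0 \<or> z = 1 \<or> z = 2" by auto
  then show ?case using of_int by auto
qed

lemma three_mod3 [simp]: "(3::3) = 0"
  by simp

lemma UNIV_mod3: "(UNIV :: 3 set) = {0, 1, 2}"
  using cases_mod3 by auto

text \<open>
  The structure used by the proof: \<open>s\<close> generates a free action of the cyclic group of order 3, whose
  orbits are the fibers, and pairs of points in different fibers carry colours in the type \<open>3\<close> of
  integers modulo 3, such that \<open>s\<close> raises the colour by 1. The last assumption is the existence of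
  structure constants for the products of two colour relations.
\<close>

locale three_cover =
  fixes \<Omega> :: "'a set" and s :: "'a \<Rightarrow> 'a" and D :: "3 \<Rightarrow> 'a rel"
  assumes fin: "finite \<Omega>"
    and s_in: "x \<in> \<Omega> \<Longrightarrow> s x \<in> \<Omega>"
    and s_cube: "x \<in> \<Omega> \<Longrightarrow> s (s (s x)) = x"
    and s_free: "x \<in> \<Omega> \<Longrightarrow> s x \<noteq> x"
    and D_in: "D i \<subseteq> \<Omega> \<times> \<Omega>"
    and D_sym: "sym (D i)"
    and D_shift: "(x, y) \<in> D i \<Longrightarrow> (s x, y) \<in> D (i + 1)"
    and D_disj: "(x, y) \<in> D i \<Longrightarrow> (x, y) \<in> D j \<Longrightarrow> i = j"
    and D_irrefl: "(x, x) \<notin> D i"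
    and D_cover: "x \<in> \<Omega> \<Longrightarrow> y \<in> \<Omega> \<Longrightarrow> y \<notin> {x, s x, s (s x)} \<Longrightarrow> \<exists>i. (x, y) \<in> D i"
    and D_card: "x \<in> \<Omega> \<Longrightarrow> card (D i `` {x}) = 4"
    and coherent: "(x, y) \<in> D k \<Longrightarrow> (x', y') \<in> D k \<Longrightarrow>
      card {z \<in> \<Omega>. (x, z) \<in> D i \<and> (z, y) \<in> D j} = card {z \<in> \<Omega>. (x', z) \<in> D i \<and> (z, y') \<in> D j}"
begin

definition fiber :: "'a \<Rightarrow> 'a set"
  where "fiber x = {x, s x, s (s x)}"

definition paths :: "3 \<Rightarrow> 3 \<Rightarrow> 'a \<Rightarrow> 'a \<Rightarrow> nat"
  where "paths i j x y = card {z \<in> \<Omega>. (x, z) \<in> D i \<and> (z, y) \<in> D j}"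

definition S :: "'a rel"
  where "S = {(x, y). x \<in> \<Omega> \<and> y \<in> fiber x \<and> y \<noteq> x}"

lemma D_commute: "(x, y) \<in> D i \<longleftrightarrow> (y, x) \<in> D i"
  using D_sym[of i] by (auto dest: symD)

lemma s_left: "x \<in> \<Omega> \<Longrightarrow> (s x, y) \<in> D i \<longleftrightarrow> (x, y) \<in> D (i - 1)"
proof
  assume x: "x \<in> \<Omega>" and "(s x, y) \<in> D i"
  then have "(s (s (s x)), y) \<in> D (i + 1 + 1)"
    by (intro D_shift)
  moreover have "i + 1 + 1 = i - 1"
    by (cases i rule: cases_mod3) simp_all
  ultimately show "(x, y) \<in> D (i - 1)"
    using x by (simp add: s_cube)
next
  assume "(x, y) \<in> D (i - 1)"
  then show "(s x, y) \<in> D i"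
    using D_shift[of x y "i - 1"] by simp
qed

lemma s_right: "y \<in> \<Omega> \<Longrightarrow> (x, s y) \<in> D i \<longleftrightarrow> (x, y) \<in> D (i - 1)"
  using s_left[of y x i] D_commute by blast

lemma fiber_in: "x \<in> \<Omega> \<Longrightarrow> y \<in> fiber x \<Longrightarrow> y \<in> \<Omega>"
  by (auto simp: fiber_def s_in)

lemma fiber_refl [simp]: "x \<in> fiber x"
  by (simp add: fiber_def)

lemma fiber_eq: "x \<in> \<Omega> \<Longrightarrow> y \<in> fiber x \<Longrightarrow> fiber y = fiber x"
  by (auto simp: fiber_def s_cube)

lemma fiber_sym: "x \<in> \<Omega> \<Longrightarrow> y \<in> \<Omega> \<Longrightarrow> y \<in> fiber x \<longleftrightarrow> x \<in> fiber y"
  by (metis fiber_eq fiber_refl)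

lemma fiber_distinct: "x \<in> \<Omega> \<Longrightarrow> s (s x) \<noteq> x" "x \<in> \<Omega> \<Longrightarrow> s (s x) \<noteq> s x"
  using s_free s_in s_cube by metis+

lemma D_fiber: "(x, y) \<in> D i \<Longrightarrow> y \<notin> fiber x"
  using D_in[of i] D_irrefl by (auto simp: fiber_def s_right s_in)

text \<open>
  Reindexing by \<open>s\<close>; all counts of paths are compared with each other by this substitution of the
  middle point.
\<close>

lemma card_shift: "card {z \<in> \<Omega>. P (s z)} = card {z \<in> \<Omega>. P z}"
proof (rule bij_betw_same_card)
  show "bij_betw s {z \<in> \<Omega>. P (s z)} {z \<in> \<Omega>. P z}"
    by (rule bij_betw_byWitness[where f' = "\<lambda>z. s (s z)"]) (auto simp: s_cube s_in)
qed

text \<open>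
  As \<open>z\<close> runs through a fiber, the colour of \<open>(z, y)\<close> runs through all three values.
\<close>

lemma card_fiber:
  assumes "x \<in> \<Omega>" "y \<in> \<Omega>" "y \<notin> fiber x"
  shows "card {z \<in> fiber x. (z, y) \<in> D i} = 1"
proof -
  obtain k where k: "(x, y) \<in> D k"
    using D_cover assms unfolding fiber_def by blast
  have iff: "(x, y) \<in> D j \<longleftrightarrow> j = k" for j
    using k D_disj by blast
  have "i - k = 0 \<or> i - k = 1 \<or> i - k = 2"
    by (metis cases_mod3)
  \<comment> \<open>Each application of \<open>s\<close> adds 1 to \<open>k\<close>, so the point \<open>w\<close> of colour \<open>i\<close> is \<open>s\<^sup>i\<^sup>-\<^sup>k x\<close>.\<close>
  then obtain w where "w \<in> fiber x" "\<And>z. z \<in> fiber x \<Longrightarrow> (z, y) \<in> D i \<longleftrightarrow> z = w"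
  proof (elim disjE)
    assume "i - k = 0"
    then have "i = k" by simp
    with assms show ?thesis
      by (intro that[of x]) (auto simp: fiber_def s_left s_in iff s_free fiber_distinct)
  next
    assume "i - k = 1"
    then have "i = k + 1" by (simp add: algebra_simps)
    with assms show ?thesis
      by (intro that[of "s x"]) (auto simp: fiber_def s_left s_in iff s_free fiber_distinct s_free[symmetric])
  next
    assume "i - k = 2"
    then have "i = k + 2" by (simp add: algebra_simps)
    with assms show ?thesis
      by (intro that[of "s (s x)"]) (auto simp: fiber_def s_left s_in iff s_free fiber_distinct fiber_distinct[symmetric])
  qed
  then have "{z \<in> fiber x. (z, y) \<in> D i} = {w}"
    by auto
  then show ?thesis by simp
qed

lemma paths_diag: "paths (i + k) (j + k) x y = paths i j x y"
proof -
  have one: "paths (i + 1) (j + 1) x y = paths i j x y" for i j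
    using card_shift[of "\<lambda>z. (x, z) \<in> D (i + 1) \<and> (z, y) \<in> D (j + 1)"]
    by (simp add: paths_def s_left s_right cong: conj_cong)
  have "paths (i + 2) (j + 2) x y = paths i j x y"
    using one[of "i + 1" "j + 1"] one[of i j] by (simp add: add.assoc)
  then show ?thesis
    using one[of i j] by (cases k rule: cases_mod3) simp_all
qed

lemma paths_left: "x \<in> \<Omega> \<Longrightarrow> paths i j (s x) y = paths (i - 1) j x y"
  by (simp add: paths_def s_left)

lemma paths_right: "y \<in> \<Omega> \<Longrightarrow> paths i j x (s y) = paths i (j - 1) x y"
  by (simp add: paths_def s_right)

lemma paths_refl: "x \<in> \<Omega> \<Longrightarrow> paths i j x x = (if i = j then 4 else 0)"
proof -
  assume x: "x \<in> \<Omega>"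
  have "{z \<in> \<Omega>. (x, z) \<in> D i \<and> (z, x) \<in> D j} = (if i = j then D i `` {x} else {})"
    using D_in[of i] D_disj D_commute by auto
  then show ?thesis
    using x by (simp add: paths_def D_card)
qed

text \<open>
  Since \<open>(x, y)\<close> and \<open>(s x, s (s y))\<close> have the same colour, coherence shows that the count does not
  change when \<open>(i, j)\<close> is replaced by \<open>(i - 1, j - 2)\<close>. Together with the substitution of the middle
  point, which changes \<open>(i, j)\<close> by \<open>(1, 1)\<close>, this makes the count independent of \<open>j\<close>. Of the four
  neighbours of \<open>x\<close> of colour \<open>i\<close> exactly one lies in the fiber of \<open>y\<close>; the other three are shared
  equally by the three values of \<open>j\<close>.
\<close>

lemma paths_off:
  assumes xy: "x \<in> \<Omega>" "y \<in> \<Omega>" "y \<notin> fiber x"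
  shows "paths i j x y = 1"
proof -
  obtain k where k: "(x, y) \<in> D k"
    using D_cover assms unfolding fiber_def by blast
  have "(s x, s (s y)) \<in> D k"
    using k xy by (simp add: s_left s_right s_in)
  then have inv: "paths i j x y = paths (i - 1) (j - 2) x y" for i j
    using coherent[OF k, of "s x" "s (s y)" i j] xy
    by (simp add: paths_def[symmetric] paths_left paths_right s_in)
  have step: "paths i (j + 1) x y = paths i j x y" for j
    using inv[of i "j + 1"] paths_diag[of i "-1" j x y] by simp
  have step2: "paths i (j + 2) x y = paths i j x y" for j
    using step[of "j + 1"] step[of j] by (simp add: add.assoc)
  have const: "paths i j x y = paths i 0 x y" for j
    using step[of 0] step2[of 0] by (cases j rule: cases_mod3) simp_all
  let ?B = "{z \<in> fiber y. (z, x) \<in> D i}"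
  let ?Z = "\<lambda>j. {z \<in> \<Omega>. (x, z) \<in> D i \<and> (z, y) \<in> D j}"
  have "D i `` {x} = ?B \<union> (\<Union>j. ?Z j)"
  proof
    show "D i `` {x} \<subseteq> ?B \<union> (\<Union>j. ?Z j)"
    proof
      fix z assume "z \<in> D i `` {x}"
      then have z: "(x, z) \<in> D i" "z \<in> \<Omega>" "(z, x) \<in> D i"
        using D_in[of i] D_commute by auto
      then show "z \<in> ?B \<union> (\<Union>j. ?Z j)"
        using D_cover[OF xy(2) z(2)] D_commute by (auto simp: fiber_def)
    qed
  qed (use D_commute in auto)
  moreover have "card (?B \<union> (\<Union>j. ?Z j)) = card ?B + card (\<Union>j. ?Z j)"
  proof (rule card_Un_disjoint)
    show "?B \<inter> (\<Union>j. ?Z j) = {}"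
      using D_fiber D_commute by blast
    show "finite ?B" by (simp add: fiber_def)
    show "finite (\<Union>j. ?Z j)" using fin by auto
  qed
  moreover have "card (\<Union>j. ?Z j) = (\<Sum>j\<in>UNIV. paths i j x y)"
    unfolding paths_def
    by (rule card_UN_disjoint) (use fin D_disj in auto)
  moreover have "card ?B = 1"
    using card_fiber[OF xy(2,1)] xy fiber_sym by blast
  moreover have "(\<Sum>j\<in>UNIV. paths i j x y) = (\<Sum>j\<in>(UNIV :: 3 set). paths i 0 x y)"
    by (intro sum.cong refl const)
  ultimately have "4 = 1 + 3 * paths i 0 x y"
    using D_card[OF xy(1), of i] by simp
  then show ?thesis
    using const[of j] by simp
qed

lemma paths_fiber:
  assumes "x \<in> \<Omega>"
  shows "paths i j x (s x) = (if j = i + 1 then 4 else 0)"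
    and "paths i j x (s (s x)) = (if j = i + 2 then 4 else 0)"
  using assms by (auto simp: paths_right paths_refl s_in)

text \<open>
  Twice the Jordan product of \<open>D i\<close> and \<open>D j\<close>. For \<open>y = s x\<close> or \<open>y = s (s x)\<close> exactly one of the
  two summands is nonzero if \<open>i \<noteq> j\<close>.
\<close>

lemma paths_sym_sum:
  assumes "x \<in> \<Omega>" "y \<in> \<Omega>"
  shows "paths i j x y + paths j i x y =
    (if y = x then if i = j then 8 else 0
     else if y \<in> fiber x then if i = j then 0 else 4
     else 2)"
proof (cases "y \<in> fiber x")
  case True
  have mod3: "(i = j + 1 \<or> j = i + 1) = (i \<noteq> j)" "(i = j + 2 \<or> j = i + 2) = (i \<noteq> j)"
    "\<not> (i = j + 1 \<and> j = i + 1)" "\<not> (i = j + 2 \<and> j = i + 2)"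
    by (cases i rule: cases_mod3; cases j rule: cases_mod3; simp)+
  show ?thesis
    using True assms mod3 by (auto simp: fiber_def paths_refl paths_fiber s_free fiber_distinct)
next
  case False
  then have "y \<noteq> x" by (auto simp: fiber_def)
  then show ?thesis
    using False assms by (simp add: paths_off)
qed

end

section \<open>The switched scheme\<close>

locale island = three_cover +
  fixes a
  assumes a_in: "a \<in> \<Omega>"
begin

text \<open>
  Negation modulo 3 fixes 0 and exchanges 1 and 2, so it describes the exchange of the bridges of
  \<open>D 1\<close> and \<open>D 2\<close> uniformly in \<open>i\<close>. The island is the fiber of \<open>a\<close>.
\<close>

definition sw :: "3 \<Rightarrow> 'a rel"
  where "sw i = continent_part \<Omega> (fiber a) (D i) \<union> bridge \<Omega> (fiber a) (D (- i))"

definition sw_paths :: "3 \<Rightarrow> 3 \<Rightarrow> 'a \<Rightarrow> 'a \<Rightarrow> nat"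
  where "sw_paths i j x y = card {z \<in> \<Omega>. (x, z) \<in> sw i \<and> (z, y) \<in> sw j}"

definition switched :: "'a rel set"
  where "switched = insert (Id_on \<Omega>) (insert S (range sw))"

lemma island_fiber: "x \<in> \<Omega> \<Longrightarrow> y \<in> fiber x \<Longrightarrow> y \<in> fiber a \<longleftrightarrow> x \<in> fiber a"
  using a_in fiber_eq fiber_refl fiber_sym by metis

lemma D_island: "(x, y) \<in> D i \<Longrightarrow> x \<in> fiber a \<Longrightarrow> y \<notin> fiber a"
  using D_fiber fiber_eq a_in by metis

text \<open>
  As \<open>D i\<close> contains no pair inside the island, the index is negated precisely on the pairs that meet
  the island.
\<close>

lemma sw_iff: "(x, y) \<in> sw i \<longleftrightarrow> (x, y) \<in> D (if x \<in> fiber a \<or> y \<in> fiber a then - i else i)"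
  using D_in D_island by (auto simp: sw_def continent_part_def bridge_def)

lemma sw_commute: "(x, y) \<in> sw i \<longleftrightarrow> (y, x) \<in> sw i"
  by (simp add: sw_iff D_commute[of x y] disj_commute)

lemma sw_in: "(x, y) \<in> sw i \<Longrightarrow> x \<in> \<Omega> \<and> y \<in> \<Omega>"
  using D_in by (auto simp: sw_iff)

lemma sw_fiber: "(x, y) \<in> sw i \<Longrightarrow> y \<notin> fiber x"
  using D_fiber by (simp add: sw_iff)

lemma sw_disj: "(x, y) \<in> sw i \<Longrightarrow> (x, y) \<in> sw j \<Longrightarrow> i = j"
  by (auto simp: sw_iff split: if_splits dest: D_disj)

lemma sw_cover: "x \<in> \<Omega> \<Longrightarrow> y \<in> \<Omega> \<Longrightarrow> y \<notin> fiber x \<Longrightarrow> \<exists>i. (x, y) \<in> sw i"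
proof -
  assume "x \<in> \<Omega>" "y \<in> \<Omega>" "y \<notin> fiber x"
  then obtain i where "(x, y) \<in> D i"
    using D_cover unfolding fiber_def by blast
  then have "(x, y) \<in> sw (if x \<in> fiber a \<or> y \<in> fiber a then - i else i)"
    by (simp add: sw_iff)
  then show ?thesis by blast
qed

lemma sw_0: "sw 0 = D 0"
  by (auto simp: sw_iff split: if_splits)

lemma sw_1: "sw 1 = continent_part \<Omega> (fiber a) (D 1) \<union> bridge \<Omega> (fiber a) (D 2)"
  and sw_2: "sw 2 = continent_part \<Omega> (fiber a) (D 2) \<union> bridge \<Omega> (fiber a) (D 1)"
proof -
  have "- (1::3) = 2" "- (2::3) = 1"
    by simp_all
  then show "sw 1 = continent_part \<Omega> (fiber a) (D 1) \<union> bridge \<Omega> (fiber a) (D 2)"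
    "sw 2 = continent_part \<Omega> (fiber a) (D 2) \<union> bridge \<Omega> (fiber a) (D 1)"
    by (simp_all only: sw_def)
qed

lemma card_fiber_sw:
  assumes "x \<in> \<Omega>" "y \<in> \<Omega>" "y \<notin> fiber x"
  shows "card {z \<in> fiber x. (z, y) \<in> sw i} = 1"
proof -
  have "(z, y) \<in> sw i \<longleftrightarrow> (z, y) \<in> D (if x \<in> fiber a \<or> y \<in> fiber a then - i else i)"
    if "z \<in> fiber x" for z
    by (simp only: sw_iff island_fiber[OF assms(1) that])
  then have "{z \<in> fiber x. (z, y) \<in> sw i} =
      {z \<in> fiber x. (z, y) \<in> D (if x \<in> fiber a \<or> y \<in> fiber a then - i else i)}"
    by blast
  then show ?thesis
    using card_fiber[OF assms] by simp
qed

text \<open>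
  The heart of the switching. Paths through the continent keep their colours. If \<open>f i j\<close> counts the
  paths through the island before the switching, then \<open>f (- i) (- j)\<close> counts them afterwards.
  Moving the middle point within the island changes both indices by the same amount, here by
  \<open>i + j\<close>, whence \<open>f (- i) (- j) = f j i\<close>: the individual products change, but not their sum.
\<close>

lemma sw_paths_sym_sum_continent:
  assumes "x \<in> \<Omega>" "y \<in> \<Omega>" "x \<notin> fiber a" "y \<notin> fiber a"
  shows "sw_paths i j x y + sw_paths j i x y = paths i j x y + paths j i x y"
proof -
  define f where "f i j = card {z \<in> \<Omega>. z \<in> fiber a \<and> (x, z) \<in> D i \<and> (z, y) \<in> D j}" for i j
  define g where "g i j = card {z \<in> \<Omega>. z \<notin> fiber a \<and> (x, z) \<in> D i \<and> (z, y) \<in> D j}" for i j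
  have split: "card {z \<in> \<Omega>. P z} =
      card {z \<in> \<Omega>. z \<notin> fiber a \<and> P z} + card {z \<in> \<Omega>. z \<in> fiber a \<and> P z}" for P
    using fin by (subst card_Un_disjoint[symmetric]) (auto intro!: arg_cong[where f = card])
  have sw: "sw_paths i j x y = g i j + f (- i) (- j)" for i j
  proof -
    have "z \<notin> fiber a \<and> (x, z) \<in> sw i \<and> (z, y) \<in> sw j \<longleftrightarrow>
        z \<notin> fiber a \<and> (x, z) \<in> D i \<and> (z, y) \<in> D j"
      "z \<in> fiber a \<and> (x, z) \<in> sw i \<and> (z, y) \<in> sw j \<longleftrightarrow>
        z \<in> fiber a \<and> (x, z) \<in> D (- i) \<and> (z, y) \<in> D (- j)" for z
      using assms(3,4) by (auto simp: sw_iff)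
    then show ?thesis
      unfolding sw_paths_def f_def g_def by (subst split) simp
  qed
  have orig: "paths i j x y = g i j + f i j" for i j
    unfolding paths_def f_def g_def by (subst split) simp
  have s_island: "z \<in> \<Omega> \<Longrightarrow> s z \<in> fiber a \<longleftrightarrow> z \<in> fiber a" for z
    using island_fiber[of z "s z"] by (simp add: fiber_def)
  have one: "f (i + 1) (j + 1) = f i j" for i j
    using card_shift[of "\<lambda>z. z \<in> fiber a \<and> (x, z) \<in> D (i + 1) \<and> (z, y) \<in> D (j + 1)"]
    by (simp add: f_def s_left s_right s_island cong: conj_cong)
  have "f (i + 2) (j + 2) = f i j" for i j
    using one[of "i + 1" "j + 1"] one[of i j] by (simp add: add.assoc)
  then have "f (i + k) (j + k) = f i j" for i j k
    using one[of i j] by (cases k rule: cases_mod3) simp_all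
  from this[of "- i" "i + j" "- j"] this[of "- j" "i + j" "- i"]
  have "f (- i) (- j) = f j i" "f (- j) (- i) = f i j"
    by simp_all
  then show ?thesis
    by (simp add: sw orig)
qed

lemma sw_paths_island:
  assumes "x \<in> fiber a" "y \<in> fiber a"
  shows "sw_paths i j x y = paths (- i) (- j) x y"
  using assms by (auto simp: sw_paths_def paths_def sw_iff)

text \<open>
  The switching does not change Jordan products. In the island both indices of a path are negated,
  which does not affect the value of \<open>paths_sym_sum\<close>. Across the bridge every count is 1, before and
  after, whatever the indices are.
\<close>

lemma sw_paths_sym_sum:
  assumes xy: "x \<in> \<Omega>" "y \<in> \<Omega>"
  shows "sw_paths i j x y + sw_paths j i x y = paths i j x y + paths j i x y"
proof -
  have bridge: "sw_paths i j x y = 1" if "x \<in> fiber a" "y \<notin> fiber a" "x \<in> \<Omega>" "y \<in> \<Omega>" for i j x y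
  proof -
    have "sw_paths i j x y = paths (- i) j x y"
      using that D_island[of x] unfolding sw_paths_def paths_def
      by (intro arg_cong[where f = card]) (auto simp: sw_iff)
    moreover have "y \<notin> fiber x"
      using that island_fiber[of x y] by blast
    ultimately show ?thesis
      using that paths_off by simp
  qed
  have flip: "sw_paths i j x y = sw_paths j i y x" for i j x y
    unfolding sw_paths_def using sw_commute by (intro arg_cong[where f = card]) auto
  consider "x \<in> fiber a" "y \<in> fiber a" | "x \<in> fiber a" "y \<notin> fiber a" | "x \<notin> fiber a" "y \<in> fiber a"
    | "x \<notin> fiber a" "y \<notin> fiber a"
    by blast
  then show ?thesis
  proof cases
    case 1
    then show ?thesis
      using paths_sym_sum[OF xy, of "- i" "- j"] paths_sym_sum[OF xy, of i j]
      by (simp add: sw_paths_island)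
  next
    case 2
    then have "y \<notin> fiber x"
      using xy island_fiber[of x y] by blast
    then show ?thesis
      using 2 xy by (simp add: bridge paths_off)
  next
    case 3
    then have "y \<notin> fiber x"
      using xy island_fiber[of x y] by blast
    then show ?thesis
      using 3 xy by (simp add: bridge paths_off flip[of _ _ x y])
  next
    case 4
    then show ?thesis
      using xy by (intro sw_paths_sym_sum_continent)
  qed
qed

text \<open>
  The adjacency matrix of \<open>S\<close> is that of the equivalence with the fibers as classes, minus the
  identity; by \<open>card_fiber_sw\<close> the equivalence contributes 1 to every pair of points in different
  fibers.
\<close>

lemma S_sw_paths:
  assumes xy: "x \<in> \<Omega>" "y \<in> \<Omega>"
  shows "card {z \<in> \<Omega>. (x, z) \<in> S \<and> (z, y) \<in> sw i} = (if y \<in> fiber x \<or> (x, y) \<in> sw i then 0 else 1)"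
proof -
  let ?Z = "{z \<in> fiber x. (z, y) \<in> sw i}"
  have Z: "{z \<in> \<Omega>. (x, z) \<in> S \<and> (z, y) \<in> sw i} = ?Z - {x}"
    using xy fiber_in by (auto simp: S_def)
  show ?thesis
  proof (cases "y \<in> fiber x")
    case True
    then have empty: "?Z = {}"
      using sw_fiber fiber_eq xy by blast
    show ?thesis
      unfolding Z empty using True by simp
  next
    case False
    show ?thesis
      unfolding Z card_Diff_singleton_if card_fiber_sw[OF xy False] using False by simp
  qed
qed

lemma sw_S_paths:
  assumes xy: "x \<in> \<Omega>" "y \<in> \<Omega>"
  shows "card {z \<in> \<Omega>. (x, z) \<in> sw i \<and> (z, y) \<in> S} = (if y \<in> fiber x \<or> (x, y) \<in> sw i then 0 else 1)"
proof -
  have reverse: "{z \<in> \<Omega>. (x, z) \<in> sw i \<and> (z, y) \<in> S} = {z \<in> \<Omega>. (y, z) \<in> S \<and> (z, x) \<in> sw i}"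
    using xy sw_commute fiber_sym by (auto simp: S_def)
  have "x \<in> fiber y \<or> (y, x) \<in> sw i \<longleftrightarrow> y \<in> fiber x \<or> (x, y) \<in> sw i"
    using fiber_sym[OF xy] sw_commute by blast
  then show ?thesis
    by (simp only: reverse S_sw_paths[OF xy(2,1)])
qed

lemma S_S_paths:
  assumes xy: "x \<in> \<Omega>" "y \<in> \<Omega>"
  shows "card {z \<in> \<Omega>. (x, z) \<in> S \<and> (z, y) \<in> S} = (if y = x then 2 else if y \<in> fiber x then 1 else 0)"
proof -
  have "(x, z) \<in> S \<and> (z, y) \<in> S \<longleftrightarrow> z \<in> fiber x \<and> z \<noteq> x \<and> z \<noteq> y \<and> y \<in> fiber x" for z
    using xy fiber_in[OF xy(1)] fiber_eq[OF xy(1), of z] by (auto simp: S_def)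
  then have Z: "{z \<in> \<Omega>. (x, z) \<in> S \<and> (z, y) \<in> S} = (if y \<in> fiber x then fiber x - {x, y} else {})"
    using fiber_in[OF xy(1)] by auto
  have "card (fiber x) = 3"
    using xy by (simp add: fiber_def s_free fiber_distinct s_free[symmetric] fiber_distinct[symmetric])
  moreover have "finite (fiber x)" by (simp add: fiber_def)
  ultimately show ?thesis
    unfolding Z by (simp add: card_Diff_subset)
qed

lemma sw_nonempty: "sw i \<noteq> {}"
proof -
  have "D i `` {a} \<noteq> {}" for i
    using D_card[OF a_in, of i] by auto
  then obtain y where "(a, y) \<in> D (- i)" by fastforce
  then have "(a, y) \<in> sw i" by (simp add: sw_iff)
  then show ?thesis by blast
qed

lemma switched_partition: "partition_on (\<Omega> \<times> \<Omega>) switched"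
proof (rule partition_onI)
  show "\<Union> switched = \<Omega> \<times> \<Omega>"
  proof
    show "\<Union> switched \<subseteq> \<Omega> \<times> \<Omega>"
      unfolding switched_def S_def by (auto dest: sw_in intro: fiber_in)
    have "(x, y) \<in> \<Union> switched" if "x \<in> \<Omega>" "y \<in> \<Omega>" for x y
    proof (cases "y \<in> fiber x")
      case True
      then have "(x, y) \<in> Id_on \<Omega> \<or> (x, y) \<in> S"
        using that by (auto simp: S_def)
      then show ?thesis unfolding switched_def by blast
    next
      case False
      then show ?thesis
        using sw_cover[OF that] unfolding switched_def by blast
    qed
    then show "\<Omega> \<times> \<Omega> \<subseteq> \<Union> switched" by auto
  qed
  show "disjnt p q" if "p \<in> switched" "q \<in> switched" "p \<noteq> q" for p q
    using that unfolding switched_def disjnt_def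
    by (auto simp: S_def dest: sw_fiber sw_disj)
  have "(a, s a) \<in> S"
    using a_in s_free by (auto simp: S_def fiber_def)
  moreover have "(a, a) \<in> Id_on \<Omega>"
    using a_in by blast
  ultimately show "{} \<notin> switched"
    using sw_nonempty unfolding switched_def by blast
qed

lemma finite_switched: "finite switched"
  by (simp add: switched_def)

lemma S_sym: "(x, y) \<in> S \<Longrightarrow> (y, x) \<in> S"
  using fiber_in fiber_sym unfolding S_def by blast

lemma switched_sym:
  assumes "R \<in> switched"
  shows "sym R"
proof -
  from assms consider "R = Id_on \<Omega>" | "R = S" | i where "R = sw i"
    unfolding switched_def by blast
  then show ?thesis
    by cases (metis symI S_sym sw_commute sym_Id_on)+
qed

lemma switched_jordan: "jordan_scheme \<Omega> switched"
proof -
  note mp = mat_prod_adj[OF fin]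
  have const: "jordan_prod \<Omega> (adj R) (adj Q) x y = jordan_prod \<Omega> (adj R) (adj Q) x' y'"
    if RQ: "R \<in> switched" "Q \<in> switched" and T: "T \<in> switched" "(x, y) \<in> T" "(x', y') \<in> T"
    for R Q T x y x' y'
  proof -
    have in\<Omega>: "x \<in> \<Omega>" "y \<in> \<Omega>" "x' \<in> \<Omega>" "y' \<in> \<Omega>"
      using T switched_partition unfolding partition_on_def by auto
    have mem: "(x, y) \<in> R \<longleftrightarrow> (x', y') \<in> R" if "R \<in> switched" for R
      using that T partition_onD2[OF switched_partition] unfolding disjoint_def by blast
    have same: "y = x \<longleftrightarrow> y' = x'" "y \<in> fiber x \<longleftrightarrow> y' \<in> fiber x'"
      "(x, y) \<in> sw i \<longleftrightarrow> (x', y') \<in> sw i" for i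
      using mem[of "Id_on \<Omega>"] mem[of S] mem[of "sw i"] in\<Omega> by (auto simp: switched_def S_def)
    have Id: "{z \<in> \<Omega>. (x, z) \<in> Id_on \<Omega> \<and> (z, y) \<in> R} = (if (x, y) \<in> R then {x} else {})"
      "{z \<in> \<Omega>. (x, z) \<in> R \<and> (z, y) \<in> Id_on \<Omega>} = (if (x, y) \<in> R then {y} else {})"
      if "x \<in> \<Omega>" "y \<in> \<Omega>" for x y R
      using that by auto
    have S: "mat_prod \<Omega> (adj S) (adj Q) x y = mat_prod \<Omega> (adj S) (adj Q) x' y'"
        "mat_prod \<Omega> (adj Q) (adj S) x y = mat_prod \<Omega> (adj Q) (adj S) x' y'"
      if "Q = S \<or> Q \<in> range sw" for Q
      using that in\<Omega> same by (auto simp: mp S_S_paths S_sw_paths sw_S_paths)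
    have I: "mat_prod \<Omega> (adj (Id_on \<Omega>)) (adj Q) x y = mat_prod \<Omega> (adj (Id_on \<Omega>)) (adj Q) x' y'"
        "mat_prod \<Omega> (adj Q) (adj (Id_on \<Omega>)) x y = mat_prod \<Omega> (adj Q) (adj (Id_on \<Omega>)) x' y'"
      if "Q \<in> switched" for Q
      using mem[OF that] in\<Omega> by (simp_all add: mp Id)
    have sw: "jordan_prod \<Omega> (adj (sw i)) (adj (sw j)) x y = jordan_prod \<Omega> (adj (sw i)) (adj (sw j)) x' y'"
      for i j
      unfolding jordan_prod_def mp sw_paths_def[symmetric] of_nat_add[symmetric]
        sw_paths_sym_sum[OF in\<Omega>(1,2)] sw_paths_sym_sum[OF in\<Omega>(3,4)]
        paths_sym_sum[OF in\<Omega>(1,2)] paths_sym_sum[OF in\<Omega>(3,4)]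
      by (simp add: same)
    from RQ consider "R = Id_on \<Omega> \<or> Q = Id_on \<Omega>"
      | "R = S" "Q = S \<or> Q \<in> range sw" | "Q = S" "R \<in> range sw" | i j where "R = sw i" "Q = sw j"
      unfolding switched_def by blast
    then show ?thesis
      by cases (use RQ I S sw in \<open>auto simp: jordan_prod_def\<close>)
  qed
  show ?thesis
    unfolding jordan_scheme_def
    using fin switched_partition switched_sym jordan_scheme_closedI[OF fin finite_switched switched_partition const]
    by (auto simp: switched_def)
qed

text \<open>
  Before the switching these numbers are 4 and 0. The middle points are neighbours of \<open>x\<close> in
  \<open>D 0\<close> in the first case, and exactly one of the four lies in the island, where its second colour
  changes from 1 to 2. In the second case a neighbour \<open>z\<close> of \<open>s x\<close> in \<open>D 0\<close> has colour 2 to \<open>x\<close>, which the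
  switching turns into 1 for the one such \<open>z\<close> in the island.
\<close>

lemma sw_paths_continent:
  assumes x: "x \<in> \<Omega>" "x \<notin> fiber a"
  shows "sw_paths 0 1 x (s x) = 3" "sw_paths 0 1 (s x) x = 1"
proof -
  let ?A = "D 0 `` {x}"
  let ?I = "{z \<in> fiber a. (z, x) \<in> D 0}"
  have mod3: "- (2::3) = 1" "- (1::3) = 2"
    by simp_all
  have sx: "s x \<notin> fiber a"
    using x island_fiber[of x "s x"] by (auto simp: fiber_def)
  have "a \<notin> fiber x"
    using x a_in fiber_sym by blast
  then have I: "card ?I = 1"
    using x a_in fiber_sym by (intro card_fiber) auto
  have sub: "?I \<subseteq> ?A"
    using D_commute by auto
  have "{z \<in> \<Omega>. (x, z) \<in> sw 0 \<and> (z, s x) \<in> sw 1} = ?A - ?I"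
    using x sx D_in[of 0] D_disj[of _ _ 0 1] D_commute[of x]
    by (auto simp: sw_iff s_right mod3)
  moreover have "finite ?I" by (simp add: fiber_def)
  ultimately show "sw_paths 0 1 x (s x) = 3"
    using D_card[OF x(1), of 0] I sub unfolding sw_paths_def
    by (simp add: card_Diff_subset)
  let ?J = "{z \<in> fiber a. (z, x) \<in> D 2}"
  have J: "card ?J = 1"
    using x a_in \<open>a \<notin> fiber x\<close> fiber_sym by (intro card_fiber) auto
  have "{z \<in> \<Omega>. (s x, z) \<in> sw 0 \<and> (z, x) \<in> sw 1} = ?J"
    using x sx a_in fiber_in D_disj[of _ _ 1 2] D_commute[of x]
    by (auto simp: sw_iff s_left mod3)
  then show "sw_paths 0 1 (s x) x = 1"
    using J unfolding sw_paths_def by simp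
qed

lemma sw_paths_island_successor: "sw_paths 0 1 a (s a) = 0"
  using a_in by (simp add: sw_paths_island fiber_def paths_fiber)

text \<open>
  An association scheme with this symmetrization contains the adjacency matrices of all \<open>sw i\<close> in its
  span, hence also their ordinary products, and a product is constant on the basic relation \<open>R\<close>
  with \<open>S = R \<union> R\<inverse>\<close> and on its transpose. Comparing a fiber in the continent with the island
  contradicts this.
\<close>

lemma switched_proper: "proper_jordan_scheme \<Omega> switched"
proof -
  have False if as: "association_scheme \<Omega> C" and sym: "switched = symmetrization C" for C
  proof -
    have part: "partition_on (\<Omega> \<times> \<Omega>) C" and conv: "\<And>R. R \<in> C \<Longrightarrow> R\<inverse> \<in> C"
      and closed: "\<And>A B. A \<in> adj_span C \<Longrightarrow> B \<in> adj_span C \<Longrightarrow> mat_prod \<Omega> A B \<in> adj_span C"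
      using as unfolding association_scheme_def by blast+
    have finC: "finite C"
      by (rule finite_elements[OF _ part]) (simp add: fin)
    \<comment> \<open>A basic relation lies inside \<open>sw i\<close> or is disjoint from it.\<close>
    have sw_span: "adj (sw i) \<in> adj_span C" for i
    proof (rule adj_spanI[OF finC part])
      fix R x y x' y' assume R: "R \<in> C" "(x, y) \<in> R" "(x', y') \<in> R"
      have "R \<union> R\<inverse> \<in> switched"
        using R(1) sym by (auto simp: symmetrization_def)
      moreover have "sw i \<in> switched" by (simp add: switched_def)
      ultimately have "R \<union> R\<inverse> = sw i \<or> (R \<union> R\<inverse>) \<inter> sw i = {}"
        by (metis disjointD partition_onD2 switched_partition)
      then show "adj (sw i) x y = adj (sw i) x' y'"
        using R(2,3) by (auto simp: adj_def)
    qed (use sw_in in \<open>auto simp: adj_def\<close>)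
    have span: "mat_prod \<Omega> (adj (sw 0)) (adj (sw 1)) \<in> adj_span C"
      by (intro closed sw_span)
    have eq: "sw_paths 0 1 x y = sw_paths 0 1 x' y'"
      if "R \<in> C" "(x, y) \<in> R" "(x', y') \<in> R" for R x y x' y'
      using adj_span_eq[OF finC part span that] by (simp add: mat_prod_adj[OF fin] sw_paths_def)
    have "S \<in> symmetrization C"
      unfolding sym[symmetric] switched_def by simp
    then obtain R where R: "R \<in> C" "S = R \<union> R\<inverse>"
      unfolding symmetrization_def by blast
    have "D 0 `` {a} \<noteq> {}"
      using D_card[OF a_in, of 0] by auto
    then obtain x where "(a, x) \<in> sw 0"
      unfolding sw_0 by blast
    then have x: "x \<in> \<Omega>" "x \<notin> fiber a"
      using sw_in sw_fiber by blast+
    have "(x, s x) \<in> S" "(a, s a) \<in> S"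
      using x a_in s_free by (auto simp: S_def fiber_def)
    then have "(x, s x) \<in> R \<or> (s x, x) \<in> R" "(a, s a) \<in> R \<or> (a, s a) \<in> R\<inverse>"
      using R(2) by auto
    then have "sw_paths 0 1 a (s a) = sw_paths 0 1 x (s x) \<or>
        sw_paths 0 1 a (s a) = sw_paths 0 1 (s x) x"
      using eq[OF R(1), of a "s a"] eq[OF conv[OF R(1)], of a "s a"] by blast
    then show False
      using sw_paths_island_successor sw_paths_continent[OF x] by auto
  qed
  then show ?thesis
    using switched_jordan unfolding proper_jordan_scheme_def by blast
qed

end

section \<open>Two-orbits of a transformation group\<close>

locale transformation_group =
  fixes G :: "('a \<Rightarrow> 'a) set" and \<Omega> :: "'a set"
  assumes id_in: "id \<in> G"
    and comp_in: "g \<in> G \<Longrightarrow> h \<in> G \<Longrightarrow> g \<circ> h \<in> G"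
    and inv_in: "g \<in> G \<Longrightarrow> \<exists>h\<in>G. h \<circ> g = id"
    and maps: "g \<in> G \<Longrightarrow> x \<in> \<Omega> \<Longrightarrow> g x \<in> \<Omega>"
begin

definition orbitals :: "'a rel set"
  where "orbitals = {{(g x, g y) | g. g \<in> G} | x y. x \<in> \<Omega> \<and> y \<in> \<Omega>}"

lemma orbital_invariant:
  assumes "R \<in> orbitals" "g \<in> G" "(x, y) \<in> R"
  shows "(g x, g y) \<in> R"
proof -
  obtain u v where R: "R = {(h u, h v) | h. h \<in> G}"
    using assms(1) unfolding orbitals_def by blast
  then obtain h where "h \<in> G" "x = h u" "y = h v"
    using assms(3) by blast
  then show ?thesis
    unfolding R using comp_in[OF assms(2), of h] by (auto intro!: exI[of _ "g \<circ> h"])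
qed

lemma orbital_transitive:
  assumes "R \<in> orbitals" "(x, y) \<in> R" "(x', y') \<in> R"
  obtains g where "g \<in> G" "g x = x'" "g y = y'"
proof -
  obtain u v where R: "R = {(h u, h v) | h. h \<in> G}"
    using assms(1) unfolding orbitals_def by blast
  then obtain h h' where h: "h \<in> G" "x = h u" "y = h v" "h' \<in> G" "x' = h' u" "y' = h' v"
    using assms(2,3) by blast
  obtain k where k: "k \<in> G" "k \<circ> h = id"
    using inv_in[OF h(1)] by blast
  then have "k (h z) = z" for z
    by (metis comp_apply id_apply)
  then show ?thesis
    using that[of "h' \<circ> k"] h k comp_in by simp
qed

lemma orbital_cover:
  assumes "x \<in> \<Omega>" "y \<in> \<Omega>"
  shows "\<exists>R\<in>orbitals. (x, y) \<in> R"
proof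
  show "(x, y) \<in> {(g x, g y) | g. g \<in> G}"
    using id_in by (auto intro!: exI[of _ id])
  show "{(g x, g y) | g. g \<in> G} \<in> orbitals"
    using assms unfolding orbitals_def by blast
qed

lemma orbital_in: "R \<in> orbitals \<Longrightarrow> (x, y) \<in> R \<Longrightarrow> x \<in> \<Omega> \<and> y \<in> \<Omega>"
  using maps unfolding orbitals_def by auto

lemma orbital_nonempty: "R \<in> orbitals \<Longrightarrow> R \<noteq> {}"
  using id_in unfolding orbitals_def by auto

lemma orbital_eq:
  assumes "R \<in> orbitals" "Q \<in> orbitals" "(x, y) \<in> R" "(x, y) \<in> Q"
  shows "R = Q"
proof -
  have "R \<subseteq> Q" if "R \<in> orbitals" "Q \<in> orbitals" "(x, y) \<in> R" "(x, y) \<in> Q" for R Q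
  proof
    fix p assume "p \<in> R"
    moreover obtain u v where "p = (u, v)" by (cases p)
    ultimately show "p \<in> Q"
      using orbital_transitive[OF that(1,3), of u v] orbital_invariant[OF that(2) _ that(4)] by metis
  qed
  then show ?thesis
    using assms by blast
qed

lemma inj_G: "g \<in> G \<Longrightarrow> inj g"
  by (metis inv_in inj_on_id inj_on_imageI2)

text \<open>
  The two-orbits have structure constants: an element that moves one pair to another maps the
  middle points for the first pair injectively to those for the second. Equality follows by exchanging
  the pairs.
\<close>

lemma orbital_paths_le:
  assumes "finite \<Omega>" "K \<in> orbitals" "R \<in> orbitals" "Q \<in> orbitals" "(x, y) \<in> K" "(x', y') \<in> K"
  shows "card {z \<in> \<Omega>. (x, z) \<in> R \<and> (z, y) \<in> Q} \<le> card {z \<in> \<Omega>. (x', z) \<in> R \<and> (z, y') \<in> Q}"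
proof -
  obtain g where g: "g \<in> G" "g x = x'" "g y = y'"
    using orbital_transitive assms by metis
  show ?thesis
  proof (rule card_inj_on_le)
    show "inj_on g {z \<in> \<Omega>. (x, z) \<in> R \<and> (z, y) \<in> Q}"
      using inj_G[OF g(1)] inj_on_subset by blast
    show "g ` {z \<in> \<Omega>. (x, z) \<in> R \<and> (z, y) \<in> Q} \<subseteq> {z \<in> \<Omega>. (x', z) \<in> R \<and> (z, y') \<in> Q}"
      using g maps orbital_invariant[OF assms(3) g(1)] orbital_invariant[OF assms(4) g(1)] by auto
  qed (use assms in auto)
qed

end

text \<open>
  The hypotheses on the two-orbits of \<open>A\<^sub>5\<close>, for an arbitrary transformation group. The relations of
  valency 4 are indexed by the integers modulo 3; at this point the index has no meaning
  beyond distinguishing them.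
\<close>

locale rank_six_action = transformation_group G \<Omega>
  for G :: "('a \<Rightarrow> 'a) set" and \<Omega> +
  fixes S\<^sub>1 S\<^sub>2 :: "'a rel" and D :: "3 \<Rightarrow> 'a rel"
  assumes fin: "finite \<Omega>"
    and orbitals_eq: "orbitals = insert (Id_on \<Omega>) (insert S\<^sub>1 (insert S\<^sub>2 (range D)))"
    and inj_D: "inj D"
    and D_distinct: "Id_on \<Omega> \<notin> range D" "S\<^sub>1 \<notin> range D" "S\<^sub>2 \<notin> range D"
    and S_distinct: "S\<^sub>1 \<noteq> Id_on \<Omega>" "S\<^sub>2 \<noteq> Id_on \<Omega>" "S\<^sub>1 \<noteq> S\<^sub>2"
    and converse_S: "S\<^sub>2 = S\<^sub>1\<inverse>"
    and valency_S: "has_valency \<Omega> S\<^sub>1 1" "has_valency \<Omega> S\<^sub>2 1"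
    and sym_D: "sym (D i)"
    and valency_D: "has_valency \<Omega> (D i) 4"
begin

definition s :: "'a \<Rightarrow> 'a"
  where "s x = (THE y. (x, y) \<in> S\<^sub>1)"

lemma orbital [simp]: "Id_on \<Omega> \<in> orbitals" "S\<^sub>1 \<in> orbitals" "S\<^sub>2 \<in> orbitals" "D i \<in> orbitals"
  by (auto simp: orbitals_eq)

lemma S\<^sub>1_iff:
  assumes "x \<in> \<Omega>"
  shows "(x, y) \<in> S\<^sub>1 \<longleftrightarrow> y = s x"
proof -
  obtain z where "S\<^sub>1 `` {x} = {z}"
    using valency_S(1) assms unfolding has_valency_def by (metis card_1_singletonE)
  then have z: "(x, y) \<in> S\<^sub>1 \<longleftrightarrow> y = z" for y
    by auto
  then show ?thesis
    by (simp add: s_def)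
qed

lemma s_in: "x \<in> \<Omega> \<Longrightarrow> s x \<in> \<Omega>"
  using S\<^sub>1_iff[of x "s x"] orbital_in[OF orbital(2)] by blast

lemma S\<^sub>2_iff: "y \<in> \<Omega> \<Longrightarrow> (x, y) \<in> S\<^sub>2 \<longleftrightarrow> x = s y"
  using S\<^sub>1_iff by (simp add: converse_S)

lemma s_free: "x \<in> \<Omega> \<Longrightarrow> s x \<noteq> x"
  using orbital_eq[OF orbital(1,2), of x x] S_distinct S\<^sub>1_iff[of x x] by auto

text \<open>
  The graph of \<open>s\<close> is a two-orbit, so \<open>s\<close> commutes with the group.
\<close>

lemma s_equivariant: "g \<in> G \<Longrightarrow> x \<in> \<Omega> \<Longrightarrow> g (s x) = s (g x)"
  using orbital_invariant[OF orbital(2), of g x "s x"] S\<^sub>1_iff maps by blast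

text \<open>
  The two-orbit of \<open>(x, s (s x))\<close> has valency 1, as \<open>s\<close> commutes with the stabilizer of \<open>x\<close>. It is
  therefore the identity, \<open>S\<^sub>1\<close> or \<open>S\<^sub>2\<close>; the first would make \<open>S\<^sub>1\<close> symmetric and the second would give
  \<open>s\<close> a fixed point.
\<close>

lemma s_cube:
  assumes x: "x \<in> \<Omega>"
  shows "s (s (s x)) = x"
proof -
  obtain R where R: "R \<in> orbitals" "(x, s (s x)) \<in> R"
    using orbital_cover x s_in by blast
  have "R `` {x} = {s (s x)}"
  proof -
    have "y = s (s x)" if y: "(x, y) \<in> R" for y
    proof -
      obtain g where g: "g \<in> G" "g x = x" "g (s (s x)) = y"
        using orbital_transitive[OF R y] by metis
      then show ?thesis
        using s_equivariant[OF g(1) s_in[OF x]] s_equivariant[OF g(1) x] by simp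
    qed
    then show ?thesis using R(2) by blast
  qed
  then have "card (R `` {x}) = 1" by simp
  then have "R \<notin> range D"
    using valency_D x unfolding has_valency_def by (metis imageE numeral_eq_one_iff semiring_norm(83))
  then consider "R = Id_on \<Omega>" | "R = S\<^sub>1" | "R = S\<^sub>2"
    using R(1) unfolding orbitals_eq by blast
  then show ?thesis
  proof cases
    case 1
    then have "s (s x) = x" using R(2) by auto
    then have "(x, s x) \<in> S\<^sub>1" "(x, s x) \<in> S\<^sub>2"
      using x by (simp_all add: S\<^sub>1_iff S\<^sub>2_iff s_in)
    then show ?thesis
      using orbital_eq[OF orbital(2,3)] S_distinct(3) by blast
  next
    case 2
    then have "s (s x) = s x"
      using R(2) x by (simp add: S\<^sub>1_iff)
    then show ?thesis
      using s_free[OF s_in[OF x]] by blast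
  next
    case 3
    then show ?thesis
      using R(2) x by (simp add: S\<^sub>2_iff s_in)
  qed
qed

lemma S\<^sub>2_iff': "x \<in> \<Omega> \<Longrightarrow> (x, y) \<in> S\<^sub>2 \<longleftrightarrow> y = s (s x)"
  by (metis S\<^sub>2_iff orbital(3) orbital_in s_cube s_in)

lemma D_in: "(x, y) \<in> D i \<Longrightarrow> x \<in> \<Omega> \<and> y \<in> \<Omega>"
  using orbital_in orbital(4) by blast

lemma D_commute: "(x, y) \<in> D i \<longleftrightarrow> (y, x) \<in> D i"
  using sym_D[of i] by (auto dest: symD)

lemma D_disj: "(x, y) \<in> D i \<Longrightarrow> (x, y) \<in> D j \<Longrightarrow> i = j"
  using orbital_eq[OF orbital(4,4)] inj_D by (metis injD)

lemma D_fiber: "(x, y) \<in> D i \<Longrightarrow> y \<notin> {x, s x, s (s x)}"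
proof
  assume xy: "(x, y) \<in> D i" and "y \<in> {x, s x, s (s x)}"
  then have "(x, y) \<in> Id_on \<Omega> \<or> (x, y) \<in> S\<^sub>1 \<or> (x, y) \<in> S\<^sub>2"
    using D_in[OF xy] by (auto simp: S\<^sub>1_iff S\<^sub>2_iff')
  then show False
    using xy orbital_eq[OF orbital(4)] orbital D_distinct by (metis rangeI)
qed

lemma D_cover:
  assumes "x \<in> \<Omega>" "y \<in> \<Omega>" "y \<notin> {x, s x, s (s x)}"
  shows "\<exists>i. (x, y) \<in> D i"
  using orbital_cover[OF assms(1,2)] assms by (auto simp: orbitals_eq S\<^sub>1_iff S\<^sub>2_iff')

text \<open>
  All orbits of \<open>s\<close> have length 3, and 3 does not divide 4.
\<close>

lemma no_invariant_four_set:
  assumes "A \<subseteq> \<Omega>" "card A = 4" "\<And>x. x \<in> A \<Longrightarrow> s x \<in> A"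
  shows False
proof -
  obtain x where x: "x \<in> A"
    using assms(2) by fastforce
  let ?F = "{x, s x, s (s x)}"
  have x\<Omega>: "x \<in> \<Omega>" using x assms(1) by blast
  have "s (s x) \<noteq> x"
    using s_free[OF x\<Omega>] s_cube[OF x\<Omega>] by metis
  then have "card ?F = 3"
    using s_free[OF x\<Omega>] s_free[OF s_in[OF x\<Omega>]] by simp
  moreover have "?F \<subseteq> A" using x assms(3) by simp
  ultimately have "card (A - ?F) = 1"
    using assms(2) by (simp add: card_Diff_subset)
  then obtain w where w: "A - ?F = {w}"
    by (metis card_1_singletonE)
  then have wA: "w \<in> A" "w \<notin> ?F" by blast+
  have w\<Omega>: "w \<in> \<Omega>" using wA(1) assms(1) by blast
  have "s w \<in> ?F"
    using w wA assms(3) s_free[OF w\<Omega>] by blast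
  then have "s (s (s w)) \<in> ?F"
    using s_cube[OF x\<Omega>] by auto
  then show False
    using wA s_cube[OF w\<Omega>] by simp
qed

text \<open>
  Since \<open>s\<close> commutes with the group, applying it to the first component maps a two-orbit into a
  two-orbit. It cannot fix \<open>D i\<close>, as then the set of the four neighbours of a point would be
  invariant under \<open>s\<close>.
\<close>

lemma shift_exists: "\<exists>j. j \<noteq> i \<and> (\<forall>x y. (x, y) \<in> D i \<longrightarrow> (s x, y) \<in> D j)"
proof -
  obtain u v where uv: "(u, v) \<in> D i"
    using orbital_nonempty[OF orbital(4)] by fastforce
  have in\<Omega>: "u \<in> \<Omega>" "v \<in> \<Omega>" using D_in[OF uv] by auto
  have "v \<notin> {s u, s (s u), s (s (s u))}"
    using D_fiber[OF uv] s_cube[OF in\<Omega>(1)] by auto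
  then obtain j where j: "(s u, v) \<in> D j"
    using D_cover[OF s_in[OF in\<Omega>(1)] in\<Omega>(2)] by blast
  have all: "(s x, y) \<in> D j" if xy: "(x, y) \<in> D i" for x y
  proof -
    obtain g where g: "g \<in> G" "g u = x" "g v = y"
      using orbital_transitive[OF orbital(4) uv xy] by metis
    then show ?thesis
      using orbital_invariant[OF orbital(4) g(1) j] s_equivariant[OF g(1) in\<Omega>(1)] by simp
  qed
  have "j \<noteq> i"
  proof
    assume "j = i"
    show False
    proof (rule no_invariant_four_set)
      show "D i `` {v} \<subseteq> \<Omega>" using D_in by blast
      show "card (D i `` {v}) = 4"
        using valency_D in\<Omega> unfolding has_valency_def by blast
      show "s x \<in> D i `` {v}" if "x \<in> D i `` {v}" for x
        using that all D_commute \<open>j = i\<close> by blast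
    qed
  qed
  then show ?thesis using all by blast
qed

text \<open>
  The shift permutes the three relations \<open>D i\<close> without fixed points, and its third power is the
  identity because \<open>s\<close> has order 3. So it is a 3-cycle.
\<close>

lemma shift_cycle:
  assumes shift: "\<And>x y. (x, y) \<in> D i \<Longrightarrow> (s x, y) \<in> D j" and "j \<noteq> i"
    and "k \<noteq> i" "k \<noteq> j" and xy: "(x, y) \<in> D j"
  shows "(s x, y) \<in> D k"
proof -
  obtain l where l: "l \<noteq> j" "\<And>x y. (x, y) \<in> D j \<Longrightarrow> (s x, y) \<in> D l"
    using shift_exists by blast
  have "l \<noteq> i"
  proof
    assume "l = i"
    then have "(s (s (s x)), y) \<in> D i"
      using l(2) shift xy by blast
    then show False
      using xy D_in[OF xy] D_disj s_cube assms(2) by metis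
  qed
  then have "l = k"
    using l(1) assms(2,3,4)
    by (cases i rule: cases_mod3; cases j rule: cases_mod3; cases k rule: cases_mod3;
        cases l rule: cases_mod3) simp_all
  then show ?thesis using l(2) xy by blast
qed

text \<open>
  A 3-cycle that maps 0 to 1 is the addition of 1.
\<close>

lemma three_cover:
  assumes shift: "\<And>x y. (x, y) \<in> D 0 \<Longrightarrow> (s x, y) \<in> D 1"
  shows "three_cover \<Omega> s D"
proof
  show "finite \<Omega>" by (fact fin)
  show "s x \<in> \<Omega>" "s (s (s x)) = x" "s x \<noteq> x" if "x \<in> \<Omega>" for x
    using that by (fact s_in s_cube s_free)+
  show "D i \<subseteq> \<Omega> \<times> \<Omega>" for i using D_in by auto
  show "sym (D i)" for i by (fact sym_D)
  show "i = j" if "(x, y) \<in> D i" "(x, y) \<in> D j" for x y i j using that by (fact D_disj)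
  show "(x, x) \<notin> D i" for x i using D_fiber by blast
  show "\<exists>i. (x, y) \<in> D i" if "x \<in> \<Omega>" "y \<in> \<Omega>" "y \<notin> {x, s x, s (s x)}" for x y
    using that by (fact D_cover)
  show "card (D i `` {x}) = 4" if "x \<in> \<Omega>" for i x
    using that valency_D unfolding has_valency_def by blast
  show "card {z \<in> \<Omega>. (x, z) \<in> D i \<and> (z, y) \<in> D j} = card {z \<in> \<Omega>. (x', z) \<in> D i \<and> (z, y') \<in> D j}"
    if "(x, y) \<in> D k" "(x', y') \<in> D k" for x y x' y' i j k
    using that by (intro antisym orbital_paths_le[OF fin, of "D k"]) auto
  have shift1: "(s x, y) \<in> D 2" if "(x, y) \<in> D 1" for x y
    using shift_cycle[of 0 1 2, OF shift _ _ _ that] by simp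
  have shift2: "(s x, y) \<in> D 0" if "(x, y) \<in> D 2" for x y
    using shift_cycle[of 1 2 0, OF shift1 _ _ _ that] by simp
  show "(s x, y) \<in> D (i + 1)" if "(x, y) \<in> D i" for x y i
    using that shift shift1 shift2 by (cases i rule: cases_mod3) simp_all
qed

lemma symmetrization_orbitals:
  "symmetrization orbitals = insert (Id_on \<Omega>) (insert (S\<^sub>1 \<union> S\<^sub>2) (range D))"
proof -
  have "R \<union> R\<inverse> = R" if "sym R" for R :: "'a rel"
    using that by (simp add: sym_conv_converse_eq)
  then have "Id_on \<Omega> \<union> (Id_on \<Omega>)\<inverse> = Id_on \<Omega>" "D i \<union> (D i)\<inverse> = D i" for i
    using sym_D sym_Id_on by blast+
  moreover have "S\<^sub>1 \<union> S\<^sub>1\<inverse> = S\<^sub>1 \<union> S\<^sub>2" "S\<^sub>2 \<union> S\<^sub>2\<inverse> = S\<^sub>1 \<union> S\<^sub>2"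
    by (auto simp: converse_S)
  ultimately show ?thesis
    by (simp add: symmetrization_def orbitals_eq image_image)
qed

lemma switching_proper_if_shift:
  assumes shift: "\<And>x y. (x, y) \<in> D 0 \<Longrightarrow> (s x, y) \<in> D 1"
    and island: "F \<in> \<Omega> // (Id_on \<Omega> \<union> (S\<^sub>1 \<union> S\<^sub>2))"
  shows "proper_jordan_scheme \<Omega> (switching \<Omega> F (D 1) (D 2) (symmetrization orbitals))"
proof -
  obtain a where a: "a \<in> \<Omega>" "F = (Id_on \<Omega> \<union> (S\<^sub>1 \<union> S\<^sub>2)) `` {a}"
    using island by (rule quotientE)
  interpret cover: three_cover \<Omega> s D
    by (rule three_cover[OF shift])
  interpret cover: island \<Omega> s D a
    by unfold_locales (fact a)
  have F: "F = cover.fiber a"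
    using a by (auto simp: cover.fiber_def S\<^sub>1_iff S\<^sub>2_iff')
  have S: "cover.S = S\<^sub>1 \<union> S\<^sub>2"
  proof -
    have "(x, y) \<in> cover.S \<longleftrightarrow> (x, y) \<in> S\<^sub>1 \<union> S\<^sub>2" for x y
    proof (cases "x \<in> \<Omega>")
      case True
      then show ?thesis
        using s_free[OF True] cover.fiber_distinct[OF True]
        by (auto simp: cover.S_def cover.fiber_def S\<^sub>1_iff S\<^sub>2_iff')
    next
      case False
      then have "(x, y) \<notin> S\<^sub>1" "(x, y) \<notin> S\<^sub>2"
        using orbital_in orbital by blast+
      then show ?thesis
        using False by (simp add: cover.S_def)
    qed
    then show ?thesis by auto
  qed
  have "S\<^sub>1 \<union> S\<^sub>2 \<noteq> D i" for i
  proof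
    assume "S\<^sub>1 \<union> S\<^sub>2 = D i"
    moreover obtain x y where "(x, y) \<in> S\<^sub>1"
      using orbital_nonempty[OF orbital(2)] by fastforce
    ultimately show False
      using orbital_eq[OF orbital(2,4)] D_distinct(2) by blast
  qed
  moreover have "Id_on \<Omega> \<noteq> D i" for i
    using D_distinct(1) by blast
  moreover have "D 0 \<noteq> D 1" "D 0 \<noteq> D 2" "D 2 \<noteq> D 1"
    using inj_D by (simp_all add: inj_eq)
  ultimately have "switching \<Omega> F (D 1) (D 2) (symmetrization orbitals) = cover.switched"
    unfolding symmetrization_orbitals switching_def cover.switched_def S UNIV_mod3 F
    by (simp add: cover.sw_0 cover.sw_1 cover.sw_2 insert_commute)
  then show ?thesis
    using cover.switched_proper by simp
qed

lemma exchange_S: "rank_six_action G \<Omega> S\<^sub>2 S\<^sub>1 D"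
proof unfold_locales
  show "finite \<Omega>" by (rule fin)
  show "orbitals = insert (Id_on \<Omega>) (insert S\<^sub>2 (insert S\<^sub>1 (range D)))"
    unfolding orbitals_eq by (rule arg_cong[OF insert_commute])
  show "inj D" by (rule inj_D)
  show "Id_on \<Omega> \<notin> range D" "S\<^sub>2 \<notin> range D" "S\<^sub>1 \<notin> range D"
    by (rule D_distinct)+
  show "S\<^sub>2 \<noteq> Id_on \<Omega>" "S\<^sub>1 \<noteq> Id_on \<Omega>" "S\<^sub>2 \<noteq> S\<^sub>1"
    by (rule S_distinct S_distinct(3)[symmetric])+
  show "S\<^sub>1 = S\<^sub>2\<inverse>"
    unfolding converse_S by (rule converse_converse[symmetric])
  show "has_valency \<Omega> S\<^sub>2 1" "has_valency \<Omega> S\<^sub>1 1"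
    by (rule valency_S)+
  show "sym (D i)" "has_valency \<Omega> (D i) 4" for i
    by (rule sym_D valency_D)+
qed

text \<open>
  The shift maps 0 to 1 or to 2. In the second case its inverse maps 0 to 1, and the inverse belongs to
  the description in which \<open>S\<^sub>1\<close> and \<open>S\<^sub>2\<close> are exchanged.
\<close>

lemma switching_proper:
  assumes island: "F \<in> \<Omega> // (Id_on \<Omega> \<union> (S\<^sub>1 \<union> S\<^sub>2))"
  shows "proper_jordan_scheme \<Omega> (switching \<Omega> F (D 1) (D 2) (symmetrization orbitals))"
proof -
  obtain j where j: "j \<noteq> 0" "\<And>x y. (x, y) \<in> D 0 \<Longrightarrow> (s x, y) \<in> D j"
    using shift_exists by blast
  show ?thesis
  proof (cases "j = 1")
    case True
    show ?thesis
      using j(2) unfolding True by (rule switching_proper_if_shift[OF _ island])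
  next
    case False
    then have j2: "j = 2"
      using j(1) by (cases j rule: cases_mod3) auto
    interpret swapped: rank_six_action G \<Omega> S\<^sub>2 S\<^sub>1 D
      by (rule exchange_S)
    have "swapped.s x = s (s x)" if "x \<in> \<Omega>" for x
      using swapped.S\<^sub>1_iff[OF that] S\<^sub>2_iff'[OF that] by blast
    moreover have "(s (s x), y) \<in> D 1" if "(x, y) \<in> D 0" for x y
      by (rule shift_cycle[of 0 2 1, OF j(2)[unfolded j2] _ _ _ j(2)[OF that, unfolded j2]]) simp_all
    ultimately have "(swapped.s x, y) \<in> D 1" if "(x, y) \<in> D 0" for x y
      using that D_in[OF that] by metis
    moreover have "F \<in> \<Omega> // (Id_on \<Omega> \<union> (S\<^sub>2 \<union> S\<^sub>1))"
      using island by (simp only: Un_commute[of S\<^sub>1])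
    ultimately show ?thesis
      by (rule swapped.switching_proper_if_shift)
  qed
qed

end

section \<open>The alternating group of degree 5 on 15 points\<close>

lemma act_comp: "act (p \<circ> q) = act p \<circ> act q"
  by (auto simp: act_def fun_eq_iff image_image)

lemma act_id: "act id = id"
  by (simp add: act_def fun_eq_iff)

lemma act_structures15:
  assumes p: "p permutes {0..4}" and "x \<in> structures15"
  shows "act p x \<in> structures15"
proof -
  obtain P Q where x: "x = {P, Q}" and PQ: "P \<subseteq> {0..4}" "Q \<subseteq> {0..4}" "card P = 2" "card Q = 2" "P \<inter> Q = {}"
    using assms(2) unfolding structures15_def by blast
  have inj: "inj p" using p by (rule permutes_inj)
  have "p ` P \<subseteq> {0..4}" "p ` Q \<subseteq> {0..4}"
    using PQ permutes_image[OF p] by blast+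
  moreover have "card (p ` P) = 2" "card (p ` Q) = 2"
    using PQ inj by (simp_all add: card_image inj_on_subset[OF inj])
  moreover have "p ` P \<inter> p ` Q = {}"
    using PQ(5) image_Int[OF inj, of P Q] by simp
  ultimately show ?thesis
    unfolding structures15_def x act_def by auto
qed

lemma finite_structures15: "finite structures15"
proof (rule finite_subset)
  show "structures15 \<subseteq> Pow (Pow {0..4})"
    unfolding structures15_def by auto
qed simp

interpretation A5: transformation_group "act ` A5" structures15
proof
  show "id \<in> act ` A5"
    using act_id by (intro image_eqI[where x = id]) (simp_all add: A5_def permutes_id)
next
  fix g h assume "g \<in> act ` A5" "h \<in> act ` A5"
  then obtain p q where pq: "p \<in> A5" "q \<in> A5" "g = act p" "h = act q" by blast
  then have perm: "p permutes {0..4}" "q permutes {0..4}" "evenperm p" "evenperm q"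
    by (auto simp: A5_def)
  then have "permutation p" "permutation q"
    by (auto intro: permutes_imp_permutation[of "{0..4}"])
  then have "p \<circ> q \<in> A5"
    using perm by (simp add: A5_def evenperm_comp permutes_compose)
  then show "g \<circ> h \<in> act ` A5"
    using pq by (simp add: act_comp[symmetric])
next
  fix g assume "g \<in> act ` A5"
  then obtain p where p: "p \<in> A5" "g = act p" by blast
  have perm: "p permutes {0..4}" "evenperm p"
    using p by (auto simp: A5_def)
  then have "permutation p"
    by (auto intro: permutes_imp_permutation[of "{0..4}"])
  then have "inv p \<in> A5"
    using perm by (simp add: A5_def evenperm_inv permutes_inv)
  moreover have "inv p \<circ> p = id"
    using p permutes_inv_o by (auto simp: A5_def)
  ultimately show "\<exists>h\<in>act ` A5. h \<circ> g = id"
    using p by (intro bexI[of _ "act (inv p)"]) (simp_all add: act_comp[symmetric] act_id)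
next
  show "g x \<in> structures15" if "g \<in> act ` A5" "x \<in> structures15" for g x
    using that act_structures15 by (auto simp: A5_def)
qed

lemma orbitals_A5: "A5.orbitals = two_orbits15"
proof -
  have "{(g x, g y) | g. g \<in> act ` A5} = {(act p x, act p y) | p. p \<in> A5}" for x y
    by blast
  then show ?thesis
    unfolding A5.orbitals_def two_orbits15_def by simp
qed

theorem proposition12p3:
  fixes S\<^sub>1 S\<^sub>2 D\<^sub>0 D\<^sub>1 D\<^sub>2 :: "nat set set rel"
    and F :: "nat set set set"
  assumes orbits: "two_orbits15 = {Id_on structures15, S\<^sub>1, S\<^sub>2, D\<^sub>0, D\<^sub>1, D\<^sub>2}"
    and rank: "distinct [Id_on structures15, S\<^sub>1, S\<^sub>2, D\<^sub>0, D\<^sub>1, D\<^sub>2]"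
    and transposed: "S\<^sub>2 = S\<^sub>1\<inverse>"
    and valency_S: "has_valency structures15 S\<^sub>1 1" "has_valency structures15 S\<^sub>2 1"
    and sym_D: "sym D\<^sub>0" "sym D\<^sub>1" "sym D\<^sub>2"
    and valency_D: "has_valency structures15 D\<^sub>0 4" "has_valency structures15 D\<^sub>1 4"
      "has_valency structures15 D\<^sub>2 4"
    and island: "F \<in> structures15 // (Id_on structures15 \<union> (S\<^sub>1 \<union> S\<^sub>2))"
  shows "proper_jordan_scheme structures15 (switching structures15 F D\<^sub>1 D\<^sub>2 NJ15)"
proof -
  define D :: "3 \<Rightarrow> nat set set rel"
    where "D i = (if i = 0 then D\<^sub>0 else if i = 1 then D\<^sub>1 else D\<^sub>2)" for i
  have D: "D 0 = D\<^sub>0" "D 1 = D\<^sub>1" "D 2 = D\<^sub>2"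
    by (simp_all add: D_def)
  have range_D: "range D = {D\<^sub>0, D\<^sub>1, D\<^sub>2}"
    unfolding UNIV_mod3 by (simp add: D)
  have inj_D: "inj D"
  proof (rule injI)
    show "i = j" if "D i = D j" for i j
      using that rank by (cases i rule: cases_mod3; cases j rule: cases_mod3) (auto simp: D)
  qed
  interpret rank_six_action "act ` A5" structures15 S\<^sub>1 S\<^sub>2 D
  proof unfold_locales
    show "finite structures15" by (rule finite_structures15)
    show "A5.orbitals = insert (Id_on structures15) (insert S\<^sub>1 (insert S\<^sub>2 (range D)))"
      unfolding orbitals_A5 range_D by (rule orbits)
    show "inj D" by (rule inj_D)
    show "Id_on structures15 \<notin> range D" "S\<^sub>1 \<notin> range D" "S\<^sub>2 \<notin> range D"
      "S\<^sub>1 \<noteq> Id_on structures15" "S\<^sub>2 \<noteq> Id_on structures15" "S\<^sub>1 \<noteq> S\<^sub>2"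
      using rank unfolding range_D by auto
    show "S\<^sub>2 = S\<^sub>1\<inverse>" by (rule transposed)
    show "has_valency structures15 S\<^sub>1 1" "has_valency structures15 S\<^sub>2 1"
      by (rule valency_S)+
    show "sym (D i)" "has_valency structures15 (D i) 4" for i
      using sym_D valency_D by (simp_all add: D_def)
  qed
  show ?thesis
    using switching_proper[OF island] by (simp add: NJ15_def orbitals_A5 D)
qed

end
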